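(* $r^{*}(P_3,C_7)=13$.
   Context: All graphs are finite and simple. $P_3$ is the path on $3$ vertices and $C_n$ is the cycle on $n$ vertices. For graphs $F,G,H$, we write $F \rightarrow (G,H)$ if for every $2$-coloring of the edges of $F$ with colors red and blue there is a red copy of $G$ or a blue copy of $H$ in $F$ (as subgraphs). The Ramsey number is $r(G,H)=\min\{|V(F)| : F \rightarrow (G,H)\}$, and the restricted size Ramsey number is $r^{*}(G,H)=\min\{|E(F)| : F \rightarrow (G,H),\ |V(F)|=r(G,H)\}$. *)

theory Defs
  imports Main
begin

record 'a graph =
  verts :: "'a set"
  edges :: "'a set set"

definition simple_graph :: "'a graph \<Rightarrow> bool" where
  "simple_graph F \<longleftrightarrow>
     finite (verts F) \<and> (\<forall>e \<in> edges F. e \<subseteq> verts F \<and> card e = 2)"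

text \<open>A copy of \<open>G\<close> in \<open>F\<close> is a not necessarily induced subgraph of \<open>F\<close> isomorphic to \<open>G\<close>,
  given here by an embedding.\<close>

definition contains_copy :: "'a graph \<Rightarrow> 'b graph \<Rightarrow> bool" where
  "contains_copy F G \<longleftrightarrow>
     (\<exists>f. inj_on f (verts G) \<and> f ` verts G \<subseteq> verts F \<and> (\<forall>e \<in> edges G. f ` e \<in> edges F))"

datatype color = Red | Blue

definition color_subgraph :: "'a graph \<Rightarrow> ('a set \<Rightarrow> color) \<Rightarrow> color \<Rightarrow> 'a graph" where
  "color_subgraph F c k = \<lparr>verts = verts F, edges = {e \<in> edges F. c e = k}\<rparr>"

definition arrows :: "'a graph \<Rightarrow> 'b graph \<Rightarrow> 'c graph \<Rightarrow> bool" where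
  "arrows F G H \<longleftrightarrow>
     (\<forall>c. contains_copy (color_subgraph F c Red) G \<or> contains_copy (color_subgraph F c Blue) H)"

text \<open>Both minima range over all finite simple graphs. Since everything involved is invariant
  under isomorphism, it suffices to take natural numbers as vertices.\<close>

definition ramsey_number :: "'b graph \<Rightarrow> 'c graph \<Rightarrow> nat" where
  "ramsey_number G H =
     (LEAST n. \<exists>F :: nat graph. simple_graph F \<and> arrows F G H \<and> card (verts F) = n)"

definition restricted_size_ramsey_number :: "'b graph \<Rightarrow> 'c graph \<Rightarrow> nat" where
  "restricted_size_ramsey_number G H =
     (LEAST m. \<exists>F :: nat graph. simple_graph F \<and> arrows F G H \<and>
        card (verts F) = ramsey_number G H \<and> card (edges F) = m)"

definition path_graph :: "nat \<Rightarrow> nat graph" where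
  "path_graph n = \<lparr>verts = {..<n}, edges = {{i, Suc i} | i. Suc i < n}\<rparr>"

text \<open>Only meaningful as a cycle for \<open>n \<ge> 3\<close>.\<close>

definition cycle_graph :: "nat \<Rightarrow> nat graph" where
  "cycle_graph n = \<lparr>verts = {..<n}, edges = {{i, Suc i mod n} | i. i < n}\<rparr>"

lemma simple_path_graph: "simple_graph (path_graph n)"
  by (auto simp: simple_graph_def path_graph_def)

lemma simple_cycle_graph: "3 \<le> n \<Longrightarrow> simple_graph (cycle_graph n)"
  by (auto simp: simple_graph_def cycle_graph_def card_insert_if mod_Suc)

end

theory Submission
  imports Defs
begin

text \<open>
  A colouring without a red \<open>P\<^sub>3\<close> is a matching, so a graph on seven vertices arrows
  \<open>(P\<^sub>3, C\<^sub>7)\<close> iff deleting any matching leaves a Hamiltonian cycle.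

  In such a graph every degree is at least 3; let \<open>T\<close> be the set of vertices of degree exactly 3.
  A vertex of \<open>T\<close> met by the deleted matching keeps only two edges, both of which are then on the
  cycle. Hence no matching avoiding a vertex \<open>v\<close> covers three neighbours of \<open>v\<close> in \<open>T\<close>, and this
  forces every vertex to have at most two neighbours in \<open>T\<close>. With at most 12 edges the degrees sum
  to at most 24, so the vertices outside \<open>T\<close> form a triangle of vertices of degree 4, each with
  exactly two neighbours in \<open>T\<close>, and \<open>T\<close> induces a path on four vertices or a triangle with an
  isolated vertex. In each case some matching destroys all Hamiltonian cycles: it cuts the graph,
  leaves four independent vertices, or leaves two vertices of degree 2 with the same neighbours.
\<close>

section \<open>Hamiltonian cycles avoiding a matching\<close>

text \<open>A Hamiltonian cycle encoded by its adjacency relation instead of a vertex sequence: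
  symmetric, 2-regular on \<open>V\<close>, and connected, the last in the form that no proper
  nonempty subset of \<open>V\<close> is closed under \<open>C\<close>. Degree arguments then need
  no indices.\<close>

definition spanning_cycle :: "'a set \<Rightarrow> 'a set set \<Rightarrow> ('a \<Rightarrow> 'a \<Rightarrow> bool) \<Rightarrow> bool" where
  "spanning_cycle V E C \<longleftrightarrow>
     symp C \<and> (\<forall>x y. C x y \<longrightarrow> {x, y} \<in> E) \<and> (\<forall>x\<in>V. card {y. C x y} = 2) \<and>
     (\<forall>S\<subseteq>V. S \<noteq> {} \<longrightarrow> (\<forall>x\<in>S. \<forall>y. C x y \<longrightarrow> y \<in> S) \<longrightarrow> S = V)"

lemma spanning_cycle_of_copy:
  assumes copy: "contains_copy G (cycle_graph n)" and n: "card (verts G) = n" "3 \<le> n"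
  obtains C where "spanning_cycle (verts G) (edges G) C"
proof -
  obtain f where inj: "inj_on f {..<n}" and sub: "f ` {..<n} \<subseteq> verts G"
    and copy_edges: "\<forall>e\<in>edges (cycle_graph n). f ` e \<in> edges G"
    using copy unfolding contains_copy_def by (auto simp: cycle_graph_def)
  have e: "{f i, f (Suc i mod n)} \<in> edges G" if "i < n" for i
  proof -
    have "{i, Suc i mod n} \<in> edges (cycle_graph n)"
      using that by (auto simp: cycle_graph_def)
    then have "f ` {i, Suc i mod n} \<in> edges G"
      using copy_edges by blast
    then show ?thesis
      by simp
  qed
  have fin: "finite (verts G)"
    using n card.infinite by fastforce
  have img: "f ` {..<n} = verts G"
    using inj n(1) by (intro card_subset_eq fin sub) (simp add: card_image)
  define C where "C x y \<longleftrightarrow> (\<exists>i<n. x = f i \<and> y = f (Suc i mod n) \<or> y = f i \<and> x = f (Suc i mod n))" for x y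
  have mod_lt: "k mod n < n" for k
    using n by simp
  have f_eq: "f i = f j \<longleftrightarrow> i = j" if "i < n" "j < n" for i j
    using inj that by (auto simp: inj_on_def)
  \<comment> \<open>The cyclic predecessor is written with \<open>+ n\<close> because subtraction on
    naturals truncates at 0.\<close>
  have pred: "(i + n - 1) mod n = (if i = 0 then n - 1 else i - 1)" if "i < n" for i
    using that by (cases i) auto
  have nbrs: "{y. C (f i) y} = {f (Suc i mod n), f ((i + n - 1) mod n)}" if i: "i < n" for i
  proof -
    have eq: "f i = f (Suc j mod n) \<longleftrightarrow> j = (i + n - 1) mod n" if "j < n" for j
    proof -
      have "f i = f (Suc j mod n) \<longleftrightarrow> i = Suc j mod n"
        using f_eq[OF i mod_lt] .
      also have "\<dots> \<longleftrightarrow> j = (i + n - 1) mod n"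
        unfolding pred[OF i] using i that by (auto simp: mod_Suc)
      finally show ?thesis .
    qed
    have "C (f i) y \<longleftrightarrow> y = f (Suc i mod n) \<or> y = f ((i + n - 1) mod n)" for y
    proof -
      have "C (f i) y \<longleftrightarrow> (\<exists>j<n. i = j \<and> y = f (Suc j mod n) \<or> y = f j \<and> j = (i + n - 1) mod n)"
        unfolding C_def using f_eq[OF i] eq by (intro ex_cong1 conj_cong refl) simp
      then show ?thesis
        using i mod_lt by blast
    qed
    then show ?thesis
      by blast
  qed
  have card: "card {y. C (f i) y} = 2" if i: "i < n" for i
  proof -
    \<comment> \<open>Here \<open>3 \<le> n\<close> matters: on two vertices successor and
      predecessor would coincide.\<close>
    have "Suc i mod n \<noteq> (i + n - 1) mod n"
      unfolding pred[OF i] using i n by (auto simp: mod_Suc)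
    then have "f (Suc i mod n) \<noteq> f ((i + n - 1) mod n)"
      using f_eq[OF mod_lt mod_lt] by simp
    then show ?thesis
      unfolding nbrs[OF i] by simp
  qed
  have conn: "S = verts G" if S: "S \<subseteq> verts G" "S \<noteq> {}" "\<forall>x\<in>S. \<forall>y. C x y \<longrightarrow> y \<in> S" for S
  proof -
    obtain x where "x \<in> S" "x \<in> f ` {..<n}"
      using S(1,2) img by auto
    then obtain i where i: "i < n" "f i \<in> S"
      by auto
    have step: "f ((i + k) mod n) \<in> S" for k
    proof (induction k)
      case 0
      then show ?case using i by simp
    next
      case (Suc k)
      have "C (f ((i + k) mod n)) (f ((i + Suc k) mod n))"
        unfolding C_def using mod_lt by (intro exI[of _ "(i + k) mod n"]) (auto simp: mod_Suc_eq)
      then show ?case using Suc S(3) by blast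
    qed
    \<comment> \<open>Since \<open>i + (n - i + j) = n + j\<close>, this many steps from
      \<open>i\<close> end at \<open>j\<close>.\<close>
    have "f j \<in> S" if "j < n" for j
      using step[of "n - i + j"] i that by simp
    then have "verts G \<subseteq> S"
      unfolding img[symmetric] by auto
    then show ?thesis
      using S(1) by blast
  qed
  have "spanning_cycle (verts G) (edges G) C"
    unfolding spanning_cycle_def
  proof (intro conjI allI impI ballI)
    show "symp C"
      unfolding symp_def C_def by blast
    show "{x, y} \<in> edges G" if "C x y" for x y
      using that e unfolding C_def by (auto simp: insert_commute)
    show "card {y. C x y} = 2" if "x \<in> verts G" for x
      using that card unfolding img[symmetric] by auto
  qed (use conn in blast)
  then show ?thesis
    using that by blast
qed

text \<open>Colour \<open>M\<close> red and everything else blue. Disjoint edges form no red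
  \<open>P\<^sub>3\<close>, so a blue copy of \<open>H\<close> must exist.\<close>

lemma arrows_avoid_matching:
  assumes "arrows F (path_graph 3) H" and disj: "pairwise disjnt M"
  shows "contains_copy \<lparr>verts = verts F, edges = edges F - M\<rparr> H"
proof -
  let ?c = "\<lambda>e. if e \<in> M then Red else Blue"
  have "\<not> contains_copy (color_subgraph F ?c Red) (path_graph 3)"
  proof
    assume "contains_copy (color_subgraph F ?c Red) (path_graph 3)"
    then obtain f where inj: "inj_on f {..<3::nat}"
      and e: "\<forall>e\<in>edges (path_graph 3). f ` e \<in> edges (color_subgraph F ?c Red)"
      unfolding contains_copy_def by (auto simp: path_graph_def)
    have "{0, 1} \<in> edges (path_graph 3)" "{1, 2} \<in> edges (path_graph 3)"
      by (auto simp: path_graph_def numeral_2_eq_2)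
    then have "f ` {0, 1} \<in> edges (color_subgraph F ?c Red)"
      "f ` {1, 2} \<in> edges (color_subgraph F ?c Red)"
      using e by blast+
    then have "{f 0, f 1} \<in> M" "{f 1, f 2} \<in> M"
      by (auto simp: color_subgraph_def split: if_splits)
    moreover have "f 0 \<noteq> f 1" "f 0 \<noteq> f 2"
      by (simp_all add: inj_on_eq_iff[OF inj])
    ultimately show False
      using pairwiseD[OF disj, of "{f 0, f 1}" "{f 1, f 2}"] by (auto simp: disjnt_def doubleton_eq_iff)
  qed
  then have "contains_copy (color_subgraph F ?c Blue) H"
    using assms(1) unfolding arrows_def by blast
  moreover have "{e \<in> edges F. ?c e = Blue} = edges F - M"
    by auto
  ultimately show ?thesis
    unfolding color_subgraph_def by simp
qed

section \<open>Obstructions to Hamiltonicity\<close>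

text \<open>This isolates what the lower bound takes from the arrowing property. In
  \<open>cycle\<close>, \<open>M\<close> ranges over all families of pairwise disjoint sets, so it
  may contain non-edges, whose deletion changes nothing.\<close>

locale arrowing_graph =
  fixes V :: "'a set" and E :: "'a set set"
  assumes card_V: "card V = 7"
    and edge: "\<And>e. e \<in> E \<Longrightarrow> e \<subseteq> V \<and> card e = 2"
    and cycle: "\<And>M. pairwise disjnt M \<Longrightarrow> \<exists>C. spanning_cycle V (E - M) C"
begin

definition N :: "'a \<Rightarrow> 'a set" where
  "N x = {y. {x, y} \<in> E}"

definition T :: "'a set" where
  "T = {x \<in> V. card (N x) = 3}"

lemma finite_V [simp]: "finite V"
  using card_V card.infinite by fastforce

lemma N_sym: "y \<in> N x \<longleftrightarrow> x \<in> N y"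
  by (simp add: N_def insert_commute)

lemma N_subset: "N x \<subseteq> V - {x}"
  using edge unfolding N_def by fastforce

lemma N_imp_V: "y \<in> N x \<Longrightarrow> x \<in> V"
  using N_subset N_sym by blast

lemma finite_N [simp]: "finite (N x)"
  using N_subset by (rule finite_subset) simp

lemma T_subset: "T \<subseteq> V"
  by (auto simp: T_def)

lemma finite_T [simp]: "finite T"
  using T_subset by (rule finite_subset) simp

lemma cycle_avoidingD:
  assumes "spanning_cycle V (E - M) C"
  shows "\<And>x y. C x y \<Longrightarrow> C y x" "\<And>x y. C x y \<Longrightarrow> y \<in> N x \<and> {x, y} \<notin> M"
    "\<And>x. x \<in> V \<Longrightarrow> card {y. C x y} = 2"
    "\<And>S. S \<subseteq> V \<Longrightarrow> S \<noteq> {} \<Longrightarrow> (\<And>x y. x \<in> S \<Longrightarrow> C x y \<Longrightarrow> y \<in> S) \<Longrightarrow> S = V"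
proof -
  have C: "symp C" "\<forall>x y. C x y \<longrightarrow> {x, y} \<in> E - M" "\<forall>x\<in>V. card {y. C x y} = 2"
    "\<forall>S\<subseteq>V. S \<noteq> {} \<longrightarrow> (\<forall>x\<in>S. \<forall>y. C x y \<longrightarrow> y \<in> S) \<longrightarrow> S = V"
    using assms unfolding spanning_cycle_def by - (elim conjE, assumption)+
  show "C x y \<Longrightarrow> C y x" for x y
    using C(1) by (rule sympD)
  show "C x y \<Longrightarrow> y \<in> N x \<and> {x, y} \<notin> M" for x y
    using C(2)[rule_format, of x y] by (simp add: N_def)
  show "x \<in> V \<Longrightarrow> card {y. C x y} = 2" for x
    using C(3) by blast
  show "S \<subseteq> V \<Longrightarrow> S \<noteq> {} \<Longrightarrow> (\<And>x y. x \<in> S \<Longrightarrow> C x y \<Longrightarrow> y \<in> S) \<Longrightarrow> S = V" for S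
    by (rule C(4)[rule_format])
qed

text \<open>After the deletion of one edge at \<open>x\<close>, the cycle still needs two edges
  there.\<close>

lemma degree_ge_3:
  assumes "x \<in> V"
  shows "3 \<le> card (N x)"
proof (rule ccontr)
  assume less: "\<not> 3 \<le> card (N x)"
  \<comment> \<open>If \<open>x\<close> has no neighbour, \<open>y\<close> is arbitrary and the
    deletion removes nothing.\<close>
  obtain y where y: "N x \<noteq> {} \<Longrightarrow> y \<in> N x"
    by blast
  have "pairwise disjnt {{x, y}}"
    by (rule pairwise_singleton)
  then obtain C where "spanning_cycle V (E - {{x, y}}) C"
    using cycle by blast
  note C = cycle_avoidingD[OF this]
  have "{z. C x z} \<subseteq> N x - {y}"
    using C(2) by blast
  then have "2 \<le> card (N x - {y})"
    using C(3)[OF assms] card_mono[of "N x - {y}" "{z. C x z}"] by simp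
  moreover have "card (N x - {y}) \<le> 1"
    using y less by (cases "N x = {}") (simp_all add: card_Diff_singleton)
  ultimately show False
    by simp
qed

text \<open>If every vertex of \<open>S\<close> had at most one neighbour in \<open>S\<close>, the
  edges inside \<open>S\<close> would form a matching. Once they are deleted \<open>S\<close> is
  independent, so its four vertices send eight cycle edges to the three vertices outside, which can
  take only six.\<close>

lemma no_induced_matching_on_4:
  assumes S: "S \<subseteq> V" "card S = 4"
  shows "\<exists>x\<in>S. 2 \<le> card (N x \<inter> S)"
proof (rule ccontr)
  assume "\<not> (\<exists>x\<in>S. 2 \<le> card (N x \<inter> S))"
  then have le: "\<forall>x\<in>S. card (N x \<inter> S) \<le> Suc 0"
    by (auto simp: not_le less_Suc_eq_le numeral_2_eq_2)
  then have uniq: "y = z" if "x \<in> S" "y \<in> N x \<inter> S" "z \<in> N x \<inter> S" for x y z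
    using that by (metis card_le_Suc0_iff_eq finite_Int finite_N)
  let ?M = "{{x, y} |x y. x \<in> S \<and> y \<in> N x \<inter> S}"
  have "pairwise disjnt ?M"
  proof (intro pairwiseI)
    fix e e' assume "e \<in> ?M" "e' \<in> ?M" "e \<noteq> e'"
    then obtain x y x' y' where e: "e = {x, y}" "e' = {x', y'}" and
      S': "x \<in> S" "y \<in> N x \<inter> S" "x' \<in> S" "y' \<in> N x' \<inter> S"
      by blast
    then have "x \<in> N y \<inter> S" "x' \<in> N y' \<inter> S"
      using N_sym by blast+
    with uniq S' \<open>e \<noteq> e'\<close> show "disjnt e e'"
      unfolding e disjnt_def by blast
  qed
  then obtain C where "spanning_cycle V (E - ?M) C"
    using cycle by blast
  note C = cycle_avoidingD[OF this]
  have fin: "finite S"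
    using S(2) card.infinite by fastforce
  have "{y. C x y} = {y \<in> V - S. C x y}" if "x \<in> S" for x
    using C(2)[of x] N_subset that by blast
  then have "card {y \<in> V - S. C x y} = 2" if "x \<in> S" for x
    using C(3)[of x] S(1) that by auto
  then have "(\<Sum>x\<in>S. card {y \<in> V - S. C x y}) = (\<Sum>x\<in>S. 2)"
    by (intro sum.cong refl)
  moreover have "(\<Sum>x\<in>S. card {y \<in> V - S. C x y}) = (\<Sum>y\<in>V - S. card {x \<in> S. C x y})"
    by (rule sum_multicount_gen) (auto simp: fin)
  moreover have "(\<Sum>y\<in>V - S. card {x \<in> S. C x y}) \<le> (\<Sum>y\<in>V - S. 2)"
  proof (rule sum_mono)
    fix y assume "y \<in> V - S"
    then have "card {x. C y x} = 2"
      using C(3) by blast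
    moreover have "{x \<in> S. C x y} \<subseteq> {x. C y x}"
      using C(1) by blast
    ultimately show "card {x \<in> S. C x y} \<le> 2"
      using card_mono[of "{x. C y x}" "{x \<in> S. C x y}"] card_ge_0_finite[of "{x. C y x}"] by simp
  qed
  moreover have "card (V - S) = 3"
    using S card_V fin by (simp add: card_Diff_subset)
  ultimately show False
    using S(2) by simp
qed

text \<open>Each vertex of \<open>P\<close> loses one of its three edges, so the cycle uses both
  others. One of them leads to \<open>v\<close>, because \<open>M\<close> avoids \<open>v\<close>;
  but \<open>v\<close> has only two neighbours on the cycle.\<close>

lemma no_matching_covering_cubic_neighbours:
  assumes M: "M \<subseteq> E" "pairwise disjnt M" "v \<notin> \<Union>M"
    and P: "P \<subseteq> N v \<inter> T" "P \<subseteq> \<Union>M"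
  shows "card P \<le> 2"
proof (cases "P = {}")
  case False
  obtain C where "spanning_cycle V (E - M) C"
    using cycle[OF M(2)] by blast
  note C = cycle_avoidingD[OF this]
  have "C v p" if p: "p \<in> P" for p
  proof -
    obtain e where e: "p \<in> e" "e \<in> M"
      using p P by blast
    obtain q where q: "e = {p, q}" "q \<noteq> p"
      using edge[of e] e M(1) by (auto simp: card_2_iff)
    have "q \<in> N p"
      using e(2) q(1) M(1) unfolding N_def by blast
    moreover have "card (N p) = 3" "p \<in> V"
      using p P by (auto simp: T_def)
    ultimately have "card (N p - {q}) = 2"
      by simp
    moreover have "{y. C p y} \<subseteq> N p - {q}"
      using C(2) e q by blast
    ultimately have "{y. C p y} = N p - {q}"
      using C(3)[OF \<open>p \<in> V\<close>] by (intro card_subset_eq) auto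
    moreover have "v \<in> N p - {q}"
      using p P N_sym e q M(3) by blast
    ultimately show ?thesis
      using C(1) by blast
  qed
  then have "P \<subseteq> {y. C v y}"
    by blast
  moreover have "v \<in> V"
    using False P N_imp_V by blast
  then have "card {y. C v y} = 2"
    by (rule C(3))
  ultimately show ?thesis
    using card_mono[of "{y. C v y}" P] card_ge_0_finite[of "{y. C v y}"] by simp
qed simp

text \<open>Two vertices left with the same two possible neighbours force the cycle to close up as
  the 4-cycle \<open>p x q y\<close>, which misses part of \<open>V\<close>.\<close>

lemma no_common_neighbourhood:
  assumes M: "pairwise disjnt M" and pq: "p \<in> V" "q \<in> V" "p \<noteq> q"
    and p: "\<And>z. z \<in> N p \<Longrightarrow> {p, z} \<notin> M \<Longrightarrow> z \<in> {x, y}"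
    and q: "\<And>z. z \<in> N q \<Longrightarrow> {q, z} \<notin> M \<Longrightarrow> z \<in> {x, y}"
  shows False
proof -
  obtain C where "spanning_cycle V (E - M) C"
    using cycle[OF M] by blast
  note C = cycle_avoidingD[OF this]
  have xy: "{z. C r z} = {x, y}" if r: "r \<in> {p, q}" for r
  proof -
    have "{z. C r z} \<subseteq> {x, y}"
      using r C(2) p q by blast
    moreover have "card {z. C r z} = 2"
      using r pq C(3) by blast
    ultimately show ?thesis
      by (intro card_seteq) (auto simp: card_insert_if)
  qed
  have pq': "{z. C r z} = {p, q}" if r: "r \<in> {x, y}" for r
  proof -
    have sub: "{p, q} \<subseteq> {z. C r z}"
      using r xy C(1) by blast
    then have "r \<in> V"
      using C(2) N_imp_V by blast
    then have "card {z. C r z} = 2"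
      by (rule C(3))
    then show ?thesis
      using sub pq(3) card_subset_eq[of "{z. C r z}" "{p, q}"] card_ge_0_finite[of "{z. C r z}"] by simp
  qed
  have "x \<in> V" "y \<in> V"
    using pq' C(2) N_imp_V by blast+
  then have "{p, q, x, y} = V"
    using pq xy pq' by (intro C(4)) blast+
  moreover have "card {p, q, x, y} \<le> 4"
    by (simp add: card_insert_if)
  ultimately show False
    using card_V by simp
qed

text \<open>Deleting all edges that leave \<open>S\<close> makes \<open>S\<close> closed under the
  cycle relation, against connectedness.\<close>

lemma no_matching_cut:
  assumes S: "S \<subseteq> V" "S \<noteq> {}" "S \<noteq> V"
  shows "\<not> pairwise disjnt {{x, y} |x y. x \<in> S \<and> y \<in> N x - S}"
proof
  let ?M = "{{x, y} |x y. x \<in> S \<and> y \<in> N x - S}"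
  assume "pairwise disjnt ?M"
  then obtain C where "spanning_cycle V (E - ?M) C"
    using cycle by blast
  note C = cycle_avoidingD[OF this]
  have "y \<in> S" if "x \<in> S" "C x y" for x y
    using that C(2)[of x y] by blast
  then show False
    using C(4) S by blast
qed

section \<open>Neighbours of degree 3\<close>

text \<open>Suppose \<open>?A\<close> has at least three elements. Matchings that avoid
  \<open>v\<close> and cover three of them are excluded, which pins down the neighbourhoods in
  \<open>?A\<close> so tightly that some other vertex is forced into \<open>?A\<close> as
  well.\<close>

lemma cubic_neighbours_le_2: "card (N v \<inter> T) \<le> 2"
proof (rule ccontr)
  let ?A = "N v \<inter> T"
  assume "\<not> card ?A \<le> 2"
  then have card_A: "3 \<le> card ?A"
    by simp
  then have "?A \<noteq> {}"
    by auto
  then have "v \<in> V"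
    using N_imp_V by blast
  have A_V: "?A \<subseteq> V - {v}"
    using N_subset by blast
  have v_N: "v \<in> N a" "card (N a) = 3" if "a \<in> ?A" for a
    using that N_sym by (auto simp: T_def)
  \<comment> \<open>The source of the extra member: by the lower bound on degrees, a vertex confined
    to three possible neighbours is adjacent to all of them, here including
    \<open>v\<close>.\<close>
  have cubic_outside: "z \<in> ?A" if "z \<in> V" "N z \<subseteq> Y" "card Y = 3" "v \<in> Y" for z Y
  proof -
    have "N z = Y"
      using that degree_ge_3[of z] by (intro card_seteq) (auto intro: card_ge_0_finite)
    then show ?thesis
      using that N_sym by (auto simp: T_def)
  qed
  show False
  proof (cases "\<exists>a\<in>?A. \<exists>b\<in>?A. b \<in> N a")
    case True
    then obtain a b where ab: "a \<in> ?A" "b \<in> ?A" "b \<in> N a"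
      by blast
    \<comment> \<open>If \<open>c\<close> had a neighbour \<open>y\<close> outside
      \<open>{v, a, b}\<close>, the matching \<open>ab\<close>, \<open>cy\<close> would cover three
      members of \<open>?A\<close> and avoid \<open>v\<close>.\<close>
    have third: "N c = {v, a, b}" if "a \<in> ?A" "b \<in> ?A" "b \<in> N a" "c \<in> ?A" "c \<noteq> a" "c \<noteq> b" for a b c
    proof (rule card_subset_eq[of "{v, a, b}" "N c"])
      have distinct: "a \<noteq> b" "a \<noteq> v" "b \<noteq> v" "c \<noteq> v"
        using that A_V N_subset by blast+
      show "N c \<subseteq> {v, a, b}"
      proof
        fix y assume y: "y \<in> N c"
        show "y \<in> {v, a, b}"
        proof (rule ccontr)
          assume not: "y \<notin> {v, a, b}"
          have "y \<noteq> c"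
            using y N_subset by blast
          have "card {a, b, c} \<le> 2"
          proof (rule no_matching_covering_cubic_neighbours)
            show "{{a, b}, {c, y}} \<subseteq> E"
              using that(3) y by (simp add: N_def)
            show "pairwise disjnt {{a, b}, {c, y}}"
              using that(5,6) not by (auto simp: pairwise_insert disjnt_def)
            show "v \<notin> \<Union>{{a, b}, {c, y}}"
              using distinct not by auto
            show "{a, b, c} \<subseteq> ?A"
              using that by blast
          qed auto
          then show False
            using distinct that(5,6) by simp
        qed
      qed
      show "card (N c) = card {v, a, b}"
        using distinct v_N(2)[OF that(4)] by simp
    qed simp
    have "\<not> ?A \<subseteq> {a, b}"
    proof
      assume "?A \<subseteq> {a, b}"
      then have "card ?A \<le> card {a, b}"
        by (rule card_mono[rotated]) simp
      then show False
        using card_A by (simp add: card_insert_if split: if_splits)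
    qed
    then obtain c where c: "c \<in> ?A" "c \<noteq> a" "c \<noteq> b"
      by blast
    have "a \<noteq> b"
      using ab N_subset by blast
    have Nc: "N c = {v, a, b}"
      using third ab c by blast
    then have "a \<in> N c" "b \<in> N c"
      by simp_all
    then have Na: "N a = {v, c, b}" and Nb: "N b = {v, c, a}"
      using third[of c b a] third[of c a b] ab c \<open>a \<noteq> b\<close> by blast+
    \<comment> \<open>A fourth member would also be adjacent to \<open>a\<close>, whose
      neighbourhood is already full.\<close>
    have A_sub: "?A \<subseteq> {a, b, c}"
    proof
      fix d assume d: "d \<in> ?A"
      show "d \<in> {a, b, c}"
      proof (rule ccontr)
        assume "d \<notin> {a, b, c}"
        then have "N d = {v, a, b}"
          using third ab d by blast
        then have "d \<in> N a"
          using N_sym by blast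
        then show False
          using Na d A_V \<open>d \<notin> {a, b, c}\<close> by blast
      qed
    qed
    have "card (V - {a, b, c}) = 4"
      using ab c \<open>a \<noteq> b\<close> A_V card_V by (subst card_Diff_subset) auto
    then have "\<not> V - {a, b, c} \<subseteq> {v}"
      using card_mono[of "{v}" "V - {a, b, c}"] by auto
    then obtain x where x: "x \<in> V" "x \<notin> {v, a, b, c}"
      by blast
    \<comment> \<open>Now \<open>v, a, b, c\<close> form a complete graph that other vertices can
      reach only through \<open>v\<close>. This confines \<open>x\<close> to three possible
      neighbours.\<close>
    then have "x \<notin> N a" "x \<notin> N b" "x \<notin> N c"
      using Na Nb Nc by blast+
    then have "N x \<subseteq> V - {a, b, c} - {x}"
      using N_sym N_subset by blast
    moreover have "card (V - {a, b, c} - {x}) = 3"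
      using \<open>card (V - {a, b, c}) = 4\<close> x by simp
    moreover have "v \<in> V - {a, b, c} - {x}"
      using x \<open>v \<in> V\<close> ab c A_V by blast
    ultimately have "x \<in> ?A"
      using cubic_outside x(1) by blast
    then show False
      using A_sub x by blast
  next
    case False
    then have indep: "N a \<inter> ?A = {}" if "a \<in> ?A" for a
      using that by blast
    \<comment> \<open>Four members would form an independent set, which is a case of the excluded
      induced matching.\<close>
    have "\<not> 4 \<le> card ?A"
    proof
      assume "4 \<le> card ?A"
      then obtain S where S: "S \<subseteq> ?A" "card S = 4"
        using obtain_subset_with_card_n by metis
      then obtain x where "x \<in> S" "2 \<le> card (N x \<inter> S)"
        using no_induced_matching_on_4[of S] A_V by blast
      moreover from this S indep[of x] have "N x \<inter> S = {}"
        by blast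
      ultimately show False
        by simp
    qed
    then have "card ?A = 3"
      using card_A by simp
    then obtain a b c where A: "?A = {a, b, c}" and abc: "a \<noteq> b" "a \<noteq> c" "b \<noteq> c"
      by (auto simp: card_3_iff)
    define X where "X p = N p - {v}" for p
    have X: "card (X p) = 2" "X p \<inter> ?A = {}" if "p \<in> ?A" for p
      using v_N[OF that] indep[OF that] by (auto simp: X_def)
    \<comment> \<open>Distinct representatives of the sets \<open>X a\<close>, \<open>X b\<close>,
      \<open>X c\<close> give a matching that covers \<open>a\<close>, \<open>b\<close>,
      \<open>c\<close> and avoids \<open>v\<close>.\<close>
    have no_sdr: False
      if "x \<in> X a" "y \<in> X b" "z \<in> X c" "x \<noteq> y" "x \<noteq> z" "y \<noteq> z" for x y z
    proof -
      have out: "x \<notin> ?A" "y \<notin> ?A" "z \<notin> ?A"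
        using that(1-3) X(2) A by blast+
      have "card {a, b, c} \<le> 2"
      proof (rule no_matching_covering_cubic_neighbours)
        show "{{a, x}, {b, y}, {c, z}} \<subseteq> E"
          using that(1-3) by (simp add: X_def N_def)
        show "pairwise disjnt {{a, x}, {b, y}, {c, z}}"
          using that(4-6) abc out unfolding A by (auto simp: pairwise_insert disjnt_def)
        show "v \<notin> \<Union>{{a, x}, {b, y}, {c, z}}"
          using that(1-3) A A_V unfolding X_def by blast
        show "{a, b, c} \<subseteq> ?A"
          using A by simp
      qed auto
      then show False
        using abc by simp
    qed
    have two: "\<exists>z'\<in>P. z' \<noteq> z" if "card P = 2" for P :: "'a set" and z
      using that by (auto simp: card_2_iff)
    \<comment> \<open>An instance of Hall's theorem: three 2-sets lack distinct representatives only
      if they all coincide. Hence \<open>X a = X b = X c\<close>.\<close>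
    have sdr: "\<exists>x\<in>P. \<exists>y\<in>Q. \<exists>z\<in>R. x \<noteq> y \<and> x \<noteq> z \<and> y \<noteq> z"
      if card: "card P = 2" "card Q = 2" "card R = 2" and ne: "P \<noteq> Q" for P Q R :: "'a set"
    proof (rule ccontr)
      assume "\<not> ?thesis"
      then have not: "x = y \<or> x = z \<or> y = z" if "x \<in> P" "y \<in> Q" "z \<in> R" for x y z
        using that by auto
      obtain z where z: "z \<in> R"
        using two[OF card(3)] by blast
      obtain x where x: "x \<in> P" "x \<noteq> z"
        using two[OF card(1)] by blast
      obtain y where y: "y \<in> Q" "y \<noteq> z"
        using two[OF card(2)] by blast
      have "x = y"
        using not[OF x(1) y(1) z] x y by simp
      have "P \<subseteq> {x, z}" "Q \<subseteq> {x, z}"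
        using not[OF _ y(1) z] not[OF x(1) _ z] x y \<open>x = y\<close> by auto
      then have "P = {x, z}" "Q = {x, z}"
        using card x(2) by (simp_all add: card_subset_eq)
      then show False
        using ne by simp
    qed
    have Xab: "X a = X b"
      using sdr[of "X a" "X b" "X c"] no_sdr X(1) A by blast
    have Xbc: "X b = X c"
    proof (rule ccontr)
      assume "X b \<noteq> X c"
      then show False
        using sdr[of "X b" "X c" "X a"] no_sdr X(1) A by (metis insertCI)
    qed
    define Y where "Y = V - {a, b, c}"
    have "card Y = 4"
      unfolding Y_def using A A_V card_V abc by (subst card_Diff_subset) auto
    have "X a \<subseteq> Y - {v}"
      using X(2) A N_subset unfolding X_def Y_def by blast
    \<comment> \<open>Besides \<open>v\<close> and the common pair \<open>X a\<close>, the set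
      \<open>Y\<close> has one more vertex \<open>z\<close>. It is adjacent to none of
      \<open>a\<close>, \<open>b\<close>, \<open>c\<close>, so it is confined to three possible
      neighbours.\<close>
    have "\<not> Y - {v} \<subseteq> X a"
    proof
      assume "Y - {v} \<subseteq> X a"
      then have "card (Y - {v}) \<le> 2"
        using X(1)[of a] A card_mono[of "X a" "Y - {v}"] by (simp add: X_def)
      then show False
        using \<open>card Y = 4\<close> by (simp add: card_Diff_singleton_if split: if_splits)
    qed
    then obtain z where z: "z \<in> V" "z \<notin> {a, b, c}" "z \<noteq> v" "z \<notin> X a"
      unfolding Y_def by blast
    then have "z \<notin> N a" "z \<notin> N b" "z \<notin> N c"
      using Xab Xbc unfolding X_def by blast+
    then have "N z \<subseteq> Y - {z}"
      using N_sym N_subset unfolding Y_def by blast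
    moreover have "card (Y - {z}) = 3"
      using \<open>card Y = 4\<close> z unfolding Y_def by simp
    moreover have "v \<in> Y - {z}"
      using z \<open>v \<in> V\<close> A A_V unfolding Y_def by blast
    ultimately have "z \<in> ?A"
      using cubic_outside z(1) by blast
    then show False
      using A z by blast
  qed
qed

section \<open>At least 13 edges\<close>

lemma handshake: "(\<Sum>x\<in>V. card (N x)) = 2 * card E"
proof -
  have fin: "finite E"
    using edge by (intro finite_subset[of E "Pow V"]) auto
  have "card (N x) = card {e \<in> E. x \<in> e}" for x
  proof (rule bij_betw_same_card[of "\<lambda>y. {x, y}"])
    show "bij_betw (\<lambda>y. {x, y}) (N x) {e \<in> E. x \<in> e}"
    proof (rule bij_betw_imageI)
      show "inj_on (\<lambda>y. {x, y}) (N x)"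
        by (auto simp: inj_on_def doubleton_eq_iff)
      show "(\<lambda>y. {x, y}) ` N x = {e \<in> E. x \<in> e}"
      proof (intro equalityI subsetI)
        fix e assume e: "e \<in> {e \<in> E. x \<in> e}"
        then obtain y where "e = {x, y}"
          using edge[of e] by (auto simp: card_2_iff)
        then show "e \<in> (\<lambda>y. {x, y}) ` N x"
          using e by (auto simp: N_def)
      qed (auto simp: N_def)
    qed
  qed
  then have "(\<Sum>x\<in>V. card (N x)) = (\<Sum>x\<in>V. card {e \<in> E. x \<in> e})"
    by simp
  also have "\<dots> = (\<Sum>e\<in>E. card {x \<in> V. x \<in> e})"
    by (rule sum_multicount_gen) (auto simp: fin)
  also have "\<dots> = (\<Sum>e\<in>E. 2)"
  proof (rule sum.cong)
    fix e assume "e \<in> E"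
    then have "{x \<in> V. x \<in> e} = e" "card e = 2"
      using edge by blast+
    then show "card {x \<in> V. x \<in> e} = 2"
      by simp
  qed simp
  finally show ?thesis
    by simp
qed

lemma N_cases: "z \<in> N x \<Longrightarrow> z \<in> N x \<inter> T \<or> z \<in> N x \<inter> (V - T)"
  using N_subset by blast

lemma card_N_split: "card (N x) = card (N x \<inter> T) + card (N x \<inter> (V - T))"
proof -
  have "N x = (N x \<inter> T) \<union> (N x \<inter> (V - T))"
    using N_subset by blast
  moreover have "card ((N x \<inter> T) \<union> (N x \<inter> (V - T))) = card (N x \<inter> T) + card (N x \<inter> (V - T))"
    by (rule card_Un_disjoint) auto
  ultimately show ?thesis
    by simp
qed

text \<open>The ends \<open>a\<close>, \<open>d\<close> of the path have two neighbours in
  \<open>U\<close>, the inner vertices \<open>b\<close>, \<open>c\<close> have one. As each vertex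
  of \<open>U\<close> has just two neighbours in \<open>T\<close>, three configurations remain, and
  each has a fatal matching.\<close>

lemma no_cubic_path:
  assumes U: "U = V - T" "card U = 3" and U_T: "\<And>u. u \<in> U \<Longrightarrow> card (N u \<inter> T) = 2"
    and T: "T = {a, b, c, d}" "card T = 4"
    and N_T: "N a \<inter> T = {b}" "N b \<inter> T = {a, c}" "N c \<inter> T = {b, d}" "N d \<inter> T = {c}"
  shows False
proof -
  have dist: "a \<noteq> b" "a \<noteq> c" "a \<noteq> d" "b \<noteq> c" "b \<noteq> d" "c \<noteq> d"
    using T by (auto simp: card_insert_if split: if_splits)
  have in_V: "a \<in> V" "b \<in> V" "c \<in> V" "d \<in> V"
    using T T_subset by blast+
  have finU: "finite U"
    using U by auto
  note N_cases = N_cases[folded U(1)]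
  have card_split: "card (N t \<inter> T) + card (N t \<inter> U) = 3" if "t \<in> T" for t
    using that card_N_split[of t] unfolding U(1) by (simp add: T_def)
  have cards: "card (N a \<inter> U) = 2" "card (N b \<inter> U) = 1" "card (N c \<inter> U) = 1" "card (N d \<inter> U) = 2"
    using card_split[of a] card_split[of b] card_split[of c] card_split[of d] dist
    unfolding N_T by (simp_all add: T(1))
  have at_most_2: False if "u \<in> U" "P \<subseteq> N u \<inter> T" "card P = 3" for u P
    using card_mono[of "N u \<inter> T" P] U_T[OF that(1)] that by simp
  show False
  proof (cases "N a \<inter> U = N d \<inter> U")
    case True
    obtain x y where xy: "N a \<inter> U = {x, y}"
      using cards(1) by (auto simp: card_2_iff)
    \<comment> \<open>Without \<open>ab\<close> and \<open>cd\<close>, the ends \<open>a\<close> and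
      \<open>d\<close> keep the same two neighbours.\<close>
    show False
    proof (rule no_common_neighbourhood[of "{{a, b}, {c, d}}" a d x y])
      show "pairwise disjnt {{a, b}, {c, d}}"
        using dist by (auto simp: pairwise_insert disjnt_def)
      show "z \<in> {x, y}" if "z \<in> N a" "{a, z} \<notin> {{a, b}, {c, d}}" for z
        using N_cases[OF that(1)] that(2) unfolding N_T xy by blast
      show "z \<in> {x, y}" if "z \<in> N d" "{d, z} \<notin> {{a, b}, {c, d}}" for z
      proof -
        have "z \<noteq> c"
          using that(2) by (auto simp: insert_commute)
        then show ?thesis
          using N_cases[OF that(1)] unfolding N_T True[symmetric] xy by blast
      qed
    qed (use in_V dist in auto)
  next
    case False
    \<comment> \<open>The three vertices of \<open>U\<close> get names: \<open>u\<close> is adjacent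
      to \<open>a\<close> only among the two ends, \<open>v\<close> to both, \<open>w\<close> to
      \<open>d\<close> only.\<close>
    then have "\<not> N a \<inter> U \<subseteq> N d \<inter> U"
      using card_subset_eq[of "N d \<inter> U" "N a \<inter> U"] cards by auto
    then obtain u where u: "u \<in> U" "u \<in> N a" "u \<notin> N d"
      by blast
    have "card (U - {u}) = 2"
      using u U(2) by simp
    then have Nd: "N d \<inter> U = U - {u}"
      using cards(4) u finU by (intro card_subset_eq) auto
    have "card ((N a \<inter> U) - {u}) = 1"
      using cards(1) u by simp
    then obtain v where "(N a \<inter> U) - {u} = {v}"
      by (auto simp: card_1_singleton_iff)
    then have Na: "N a \<inter> U = {u, v}" "v \<in> U" "v \<noteq> u"
      using u by blast+
    have "card (U - {u} - {v}) = 1"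
      using \<open>card (U - {u}) = 2\<close> Na by simp
    then obtain w where w: "U - {u} - {v} = {w}"
      by (auto simp: card_1_singleton_iff)
    then have Uw: "U = {u, v, w}" "w \<noteq> u" "w \<noteq> v" and Nd: "N d \<inter> U = {v, w}"
      using u Na Nd by blast+
    obtain x where x: "N b \<inter> U = {x}"
      using cards(2) by (auto simp: card_1_singleton_iff)
    obtain y where y: "N c \<inter> U = {y}"
      using cards(3) by (auto simp: card_1_singleton_iff)
    have v_T: "{a, d} \<subseteq> N v \<inter> T" and u_T: "a \<in> N u \<inter> T" and w_T: "d \<in> N w \<inter> T"
      and x_T: "b \<in> N x \<inter> T" and y_T: "c \<in> N y \<inter> T"
      using Na Nd x y N_sym T(1) by blast+
    \<comment> \<open>The two places at \<open>v\<close> are taken by \<open>a\<close> and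
      \<open>d\<close>, and \<open>u\<close> and \<open>w\<close> have one place left each. So
      \<open>b\<close> and \<open>c\<close> are attached to \<open>u\<close> and \<open>w\<close> in
      one of two ways.\<close>
    have "x \<noteq> v"
      using at_most_2[of v "{a, b, d}"] v_T x_T Na dist by auto
    have "y \<noteq> v"
      using at_most_2[of v "{a, c, d}"] v_T y_T Na dist by auto
    have "\<not> (x = u \<and> y = u)"
      using at_most_2[of u "{a, b, c}"] u_T x_T y_T u dist by auto
    moreover have "\<not> (x = w \<and> y = w)"
      using at_most_2[of w "{d, b, c}"] w_T x_T y_T Uw dist by auto
    ultimately consider "x = u" "y = w" | "x = w" "y = u"
      using x y Uw(1) \<open>x \<noteq> v\<close> \<open>y \<noteq> v\<close> by blast
    then show False
    proof cases
      case 1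
      have out: "w \<notin> T" "w \<in> V"
        using U(1) Uw(1) by blast+
      \<comment> \<open>The only possible edges inside this set are \<open>ab\<close> and
        \<open>dw\<close>.\<close>
      let ?S = "{a, b, d, w}"
      have "w \<notin> N a \<inter> U" "w \<notin> N b \<inter> U" "d \<notin> N a \<inter> T" "d \<notin> N b \<inter> T"
        unfolding Na(1) x 1 N_T using Uw dist by simp_all
      then have "w \<notin> N a" "w \<notin> N b" "d \<notin> N a" "d \<notin> N b"
        by (simp_all add: Uw(1) T(1))
      moreover from this have "a \<notin> N w" "b \<notin> N w" "a \<notin> N d" "b \<notin> N d"
        by (simp_all add: N_sym[of _ w] N_sym[of _ d])
      moreover have "z \<notin> N z" for z
        using N_subset by blast
      ultimately have subs: "N a \<inter> ?S \<subseteq> {b}" "N b \<inter> ?S \<subseteq> {a}" "N d \<inter> ?S \<subseteq> {w}" "N w \<inter> ?S \<subseteq> {d}"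
        by auto
      have le_1: "card P \<le> 1" if "P \<subseteq> {q}" for P and q :: 'a
        using card_mono[of "{q}" P] that by simp
      have "card (N z \<inter> ?S) \<le> 1" if "z \<in> ?S" for z
        using that by (elim insertE emptyE) (simp_all only: subs[THEN le_1])
      moreover have "w \<notin> {a, b, c, d}"
        using out unfolding T(1) by simp
      then have "card ?S = 4"
        using dist by (auto simp: card_insert_if)
      then obtain z where "z \<in> ?S" "2 \<le> card (N z \<inter> ?S)"
        using in_V out no_induced_matching_on_4[of ?S] by blast
      ultimately show False
        by force
    next
      case 2
      \<comment> \<open>Without \<open>ab\<close> and \<open>dv\<close>, both \<open>b\<close> and
        \<open>d\<close> keep only \<open>c\<close> and \<open>w\<close>.\<close>
      show False
      proof (rule no_common_neighbourhood[of "{{a, b}, {d, v}}" b d c w])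
        have "v \<notin> T"
          using U(1) Na by blast
        then show "pairwise disjnt {{a, b}, {d, v}}"
          using dist T(1) by (auto simp: pairwise_insert disjnt_def)
        show "z \<in> {c, w}" if "z \<in> N b" "{b, z} \<notin> {{a, b}, {d, v}}" for z
        proof -
          have "z \<noteq> a"
            using that(2) by (auto simp: insert_commute)
          then show ?thesis
            using N_cases[OF that(1)] unfolding N_T x 2 by blast
        qed
        show "z \<in> {c, w}" if "z \<in> N d" "{d, z} \<notin> {{a, b}, {d, v}}" for z
          using N_cases[OF that(1)] that(2) unfolding N_T Nd by blast
      qed (use in_V dist in auto)
    qed
  qed
qed

text \<open>Each triangle vertex sends one edge to \<open>U\<close>, and \<open>d\<close>, isolated
  in \<open>T\<close>, is adjacent to all of \<open>U\<close>. Two triangle vertices with a common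
  neighbour in \<open>U\<close> would give it three neighbours in \<open>T\<close>. So the edges
  leaving the triangle form a matching, and deleting them cuts it off.\<close>

lemma no_cubic_triangle:
  assumes U: "U = V - T" "card U = 3" and U_T: "\<And>u. u \<in> U \<Longrightarrow> card (N u \<inter> T) = 2"
    and T: "T = {a, b, c, d}" "card T = 4"
    and N_T: "N a \<inter> T = {b, c}" "N b \<inter> T = {a, c}" "N c \<inter> T = {a, b}"
  shows False
proof -
  have dist: "a \<noteq> b" "a \<noteq> c" "a \<noteq> d" "b \<noteq> c" "b \<noteq> d" "c \<noteq> d"
    using T by (auto simp: card_insert_if split: if_splits)
  have finU: "finite U"
    using U by auto
  have card_split: "card (N t \<inter> T) + card (N t \<inter> U) = 3" if "t \<in> T" for t
    using that card_N_split[of t] unfolding U(1) by (simp add: T_def)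
  let ?S = "{a, b, c}"
  have S_T: "N s \<inter> T \<subseteq> ?S" "card (N s \<inter> T) = 2" if "s \<in> ?S" for s
    using that dist by (elim insertE emptyE; simp add: N_T)+
  have S_U: "card (N s \<inter> U) = 1" if "s \<in> ?S" for s
  proof -
    have "s \<in> T"
      using that T(1) by blast
    then show ?thesis
      using card_split[of s] S_T(2)[OF that] by simp
  qed
  have "d \<notin> N a \<inter> T" "d \<notin> N b \<inter> T" "d \<notin> N c \<inter> T"
    unfolding N_T using dist by simp_all
  then have "d \<notin> N a" "d \<notin> N b" "d \<notin> N c"
    by (simp_all add: T(1))
  then have "a \<notin> N d" "b \<notin> N d" "c \<notin> N d"
    by (simp_all add: N_sym[of _ d])
  moreover have "d \<notin> N d"
    using N_subset by blast
  ultimately have "N d \<inter> T = {}"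
    by (simp add: T(1))
  then have "card (N d \<inter> U) = 3"
    using card_split[of d] T(1) by simp
  then have Nd: "N d \<inter> U = U"
    using U(2) finU by (intro card_subset_eq) auto
  have cross: "y \<in> U" if "x \<in> ?S" "y \<in> N x - ?S" for x y
    using that N_cases[of y x] S_T(1)[of x] unfolding U(1) by blast
  have "pairwise disjnt {{x, y} |x y. x \<in> ?S \<and> y \<in> N x - ?S}"
  proof (intro pairwiseI)
    fix e e'
    assume "e \<in> {{x, y} |x y. x \<in> ?S \<and> y \<in> N x - ?S}" "e' \<in> {{x, y} |x y. x \<in> ?S \<and> y \<in> N x - ?S}"
      and ne: "e \<noteq> e'"
    then obtain x y x' y' where e: "e = {x, y}" "e' = {x', y'}" and
      S: "x \<in> ?S" "y \<in> N x - ?S" "x' \<in> ?S" "y' \<in> N x' - ?S"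
      by blast
    have yU: "y \<in> U" "y' \<in> U"
      using cross S by blast+
    have "y = y'" if "x = x'"
    proof -
      obtain z where "N x \<inter> U = {z}"
        using S_U[OF S(1)] by (auto simp: card_1_singleton_iff)
      moreover have "y \<in> N x \<inter> U" "y' \<in> N x \<inter> U"
        using S yU that by simp_all
      ultimately show ?thesis
        by simp
    qed
    moreover have "x = x'" if "y = y'"
    proof (rule ccontr)
      assume "x \<noteq> x'"
      have "y \<in> N x" "y \<in> N x'" "y \<in> N d"
        using S that Nd yU by blast+
      then have "{x, x', d} \<subseteq> N y"
        by (simp add: N_sym[of _ y])
      moreover have "{x, x', d} \<subseteq> T"
        using S T(1) by blast
      ultimately have "{x, x', d} \<subseteq> N y \<inter> T"
        by blast
      then have "card {x, x', d} \<le> 2"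
        using U_T[OF yU(1)] card_mono[of "N y \<inter> T" "{x, x', d}"] by simp
      moreover have "x \<noteq> d" "x' \<noteq> d"
        using S dist by blast+
      ultimately show False
        using \<open>x \<noteq> x'\<close> by simp
    qed
    moreover have "x \<noteq> y'" "x' \<noteq> y"
      using S by blast+
    ultimately show "disjnt e e'"
      using ne unfolding e disjnt_def by blast
  qed
  moreover have "?S \<subseteq> V" "?S \<noteq> V"
    using T T_subset dist by blast+
  ultimately show False
    using no_matching_cut[of ?S] by blast
qed

theorem card_edges_ge_13: "13 \<le> card E"
proof (rule ccontr)
  assume "\<not> 13 \<le> card E"
  then have sum_le: "(\<Sum>x\<in>V. card (N x)) \<le> 24"
    using handshake by simp
  define U where "U = V - T"
  have finU [simp]: "finite U"
    by (simp add: U_def)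
  have deg_U: "4 \<le> card (N u)" if "u \<in> U" for u
    using that degree_ge_3[of u] by (auto simp: U_def T_def)
  have "card V = card T + card U"
    unfolding U_def using T_subset card_mono[OF _ T_subset] by (simp add: card_Diff_subset)
  then have T_plus_U: "card T + card U = 7"
    using card_V by simp
  have "(\<Sum>x\<in>V. card (N x)) = (\<Sum>x\<in>U. card (N x)) + (\<Sum>x\<in>T. card (N x))"
    unfolding U_def by (intro sum.subset_diff T_subset) simp
  also have "(\<Sum>x\<in>T. card (N x)) = (\<Sum>x\<in>T. 3)"
    by (rule sum.cong) (auto simp: T_def)
  finally have sum_U: "(\<Sum>x\<in>U. card (N x)) + 3 * card T \<le> 24"
    using sum_le by simp
  moreover have "(\<Sum>x\<in>U. 4) \<le> (\<Sum>x\<in>U. card (N x))"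
    using deg_U by (rule sum_mono)
  \<comment> \<open>With \<open>card T = 7 - card U\<close>, the degree sum is at least
    \<open>21 + card U\<close>.\<close>
  ultimately have card_U_le: "card U \<le> 3"
    using T_plus_U by simp
  note split = card_N_split[folded U_def]
  have "U \<noteq> {}"
  proof
    assume "U = {}"
    obtain x where "x \<in> V"
      using card_V by fastforce
    then show False
      using degree_ge_3[of x] cubic_neighbours_le_2[of x] split[of x] \<open>U = {}\<close> by simp
  qed
  have U_U: "card (N u \<inter> U) \<le> card U - 1" if "u \<in> U" for u
  proof -
    have "N u \<inter> U \<subseteq> U - {u}"
      using N_subset by blast
    then show ?thesis
      using card_mono[of "U - {u}" "N u \<inter> U"] that by simp
  qed
  obtain u0 where "u0 \<in> U"
    using \<open>U \<noteq> {}\<close> by blast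
  \<comment> \<open>A vertex of \<open>U\<close> needs degree 4 from at most two neighbours in
    \<open>T\<close> and at most \<open>card U - 1\<close> in \<open>U\<close>. This forces equality
    throughout.\<close>
  then have card_U: "card U = 3"
    using deg_U[of u0] split[of u0] cubic_neighbours_le_2[of u0] U_U[of u0] card_U_le by simp
  then have card_T: "card T = 4"
    using T_plus_U by simp
  have U_T: "card (N u \<inter> T) = 2" if "u \<in> U" for u
    using deg_U[OF that] split[of u] cubic_neighbours_le_2[of u] U_U[OF that] card_U by simp
  \<comment> \<open>Six edges run between \<open>T\<close> and \<open>U\<close>, and the degrees in
    \<open>T\<close> sum to 12, so exactly three edges lie inside \<open>T\<close>.\<close>
  have "(\<Sum>t\<in>T. card {u \<in> U. u \<in> N t}) = (\<Sum>u\<in>U. card {t \<in> T. u \<in> N t})"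
    by (rule sum_multicount_gen) auto
  moreover have "{u \<in> U. u \<in> N t} = N t \<inter> U" "{t \<in> T. u \<in> N t} = N u \<inter> T" for t u
    using N_sym by blast+
  ultimately have "(\<Sum>t\<in>T. card (N t \<inter> U)) = (\<Sum>u\<in>U. card (N u \<inter> T))"
    by simp
  also have "\<dots> = (\<Sum>u\<in>U. 2)"
    using U_T by (intro sum.cong) auto
  finally have "(\<Sum>t\<in>T. card (N t \<inter> U)) = 6"
    using card_U by simp
  moreover have "(\<Sum>t\<in>T. card (N t \<inter> T) + card (N t \<inter> U)) = (\<Sum>t\<in>T. 3)"
    unfolding split[symmetric] by (rule sum.cong) (auto simp: T_def)
  ultimately have sum_T: "(\<Sum>t\<in>T. card (N t \<inter> T)) = 6"
    using card_T by (simp add: sum.distrib)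
  \<comment> \<open>Two of these three edges meet at \<open>b\<close>; the cases below locate the
    third.\<close>
  obtain b where "b \<in> T" "2 \<le> card (N b \<inter> T)"
    using no_induced_matching_on_4[OF T_subset card_T] by blast
  then have "card (N b \<inter> T) = 2"
    using cubic_neighbours_le_2[of b] by simp
  then obtain a c where Nb: "N b \<inter> T = {a, c}" and "a \<noteq> c"
    by (auto simp: card_2_iff)
  have irrefl: "x \<notin> N x" for x
    using N_subset by blast
  have "a \<in> N b \<inter> T" "c \<in> N b \<inter> T"
    unfolding Nb by simp_all
  then have abc: "a \<in> T" "c \<in> T" "a \<noteq> b" "c \<noteq> b" "b \<in> N a" "b \<in> N c"
    using irrefl by (auto simp: N_sym[of b])
  have "card (T - {a, b, c}) = 1"
    using card_T abc \<open>b \<in> T\<close> \<open>a \<noteq> c\<close> by (subst card_Diff_subset) auto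
  then obtain d where "T - {a, b, c} = {d}"
    by (auto simp: card_1_singleton_iff)
  then have T: "T = {a, b, c, d}" and d: "d \<notin> {a, b, c}"
    using abc \<open>b \<in> T\<close> by blast+
  have "d \<notin> N b \<inter> T"
    unfolding Nb using d by simp
  then have bd: "d \<notin> N b" "b \<notin> N d"
    by (simp_all add: T N_sym[of b])
  show False
  proof (cases "a \<in> N c")
    case True
    then have "{b, c} \<subseteq> N a \<inter> T" "{a, b} \<subseteq> N c \<inter> T"
      using abc \<open>b \<in> T\<close> N_sym by blast+
    moreover have "card {b, c} = 2" "card {a, b} = 2"
      using abc by simp_all
    ultimately have "{b, c} = N a \<inter> T" "{a, b} = N c \<inter> T"
      using cubic_neighbours_le_2[of a] cubic_neighbours_le_2[of c] by (simp_all add: card_seteq)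
    then show False
      using no_cubic_triangle[OF U_def card_U U_T T card_T _ Nb] by simp
  next
    case False
    then have Na: "N a \<inter> T = (if d \<in> N a then {b, d} else {b})"
      and Nc: "N c \<inter> T = (if d \<in> N c then {b, d} else {b})"
      and Nd: "N d \<inter> T = (if d \<in> N a then {a} else {}) \<union> (if d \<in> N c then {c} else {})"
      using abc bd irrefl T N_sym[of a c] N_sym[of a d] N_sym[of c d] by auto
    have "card (N a \<inter> T) + card (N b \<inter> T) + card (N c \<inter> T) + card (N d \<inter> T) = 6"
    proof -
      have "a \<noteq> b" "a \<noteq> c" "a \<noteq> d" "b \<noteq> c" "b \<noteq> d" "c \<noteq> d"
        using abc d \<open>a \<noteq> c\<close> by auto
      then have "(\<Sum>t\<in>{a, b, c, d}. f t) = f a + f b + f c + f d" for f :: "'a \<Rightarrow> nat"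
        by simp
      then show ?thesis
        using sum_T by (subst (asm) T) simp
    qed
    \<comment> \<open>The third edge joins \<open>d\<close> to exactly one of \<open>a\<close> and
      \<open>c\<close>, which extends the path at that end.\<close>
    then consider "d \<in> N c" "d \<notin> N a" | "d \<in> N a" "d \<notin> N c"
      using abc d \<open>a \<noteq> c\<close> unfolding Na Nb Nc Nd by (auto split: if_splits)
    then show False
    proof cases
      case 1
      then show False
        using no_cubic_path[OF U_def card_U U_T T card_T _ Nb] Na Nc Nd by simp
    next
      case 2
      \<comment> \<open>The same path with the roles of \<open>a\<close> and \<open>c\<close>
        exchanged.\<close>
      have "T = {c, b, a, d}" "N b \<inter> T = {c, a}"
        unfolding Nb by (subst T) auto
      from no_cubic_path[OF U_def card_U U_T this(1) card_T _ this(2)] 2 show False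
        using Na Nc Nd by simp
    qed
  qed
qed

end

section \<open>A graph with 13 edges\<close>

lemma contains_cycle_graph:
  assumes "distinct xs" "set xs \<subseteq> verts G"
    and "\<And>i. i < length xs \<Longrightarrow> {xs ! i, xs ! (Suc i mod length xs)} \<in> edges G"
  shows "contains_copy G (cycle_graph (length xs))"
  unfolding contains_copy_def
proof (intro exI conjI ballI)
  show "inj_on ((!) xs) (verts (cycle_graph (length xs)))"
    using assms(1) by (auto simp: cycle_graph_def inj_on_def nth_eq_iff_index_eq)
  show "(!) xs ` verts (cycle_graph (length xs)) \<subseteq> verts G"
    using assms(2) by (auto simp: cycle_graph_def)
  show "(!) xs ` e \<in> edges G" if "e \<in> edges (cycle_graph (length xs))" for e
    using that assms(3) by (auto simp: cycle_graph_def)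
qed

lemma contains_path_graph_3:
  assumes "{x, y} \<in> edges G" "{y, z} \<in> edges G" "{x, y, z} \<subseteq> verts G" "distinct [x, y, z]"
  shows "contains_copy G (path_graph 3)"
  unfolding contains_copy_def
proof (intro exI conjI ballI)
  have lt_3: "i < 3 \<longleftrightarrow> i = 0 \<or> i = 1 \<or> i = 2" for i :: nat
    by auto
  show "inj_on ((!) [x, y, z]) (verts (path_graph 3))"
    using assms(4) by (auto simp: path_graph_def inj_on_def lt_3)
  show "(!) [x, y, z] ` verts (path_graph 3) \<subseteq> verts G"
    using assms(3) by (auto simp: path_graph_def lt_3)
  show "(!) [x, y, z] ` e \<in> edges G" if "e \<in> edges (path_graph 3)" for e
    using that assms(1,2) by (auto simp: path_graph_def lt_3)
qed

text \<open>The vertices 3 and 6 are non-adjacent twins with neighbourhood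
  \<open>{0, 1, 2, 5}\<close>. The other edges are the 4-cycle 0, 1, 5, 4 and the edge joining 2 to
  4.\<close>

definition graph_13 :: "nat graph" where
  "graph_13 = \<lparr>verts = {..<7},
     edges = {{0, 1}, {0, 3}, {0, 4}, {0, 6}, {1, 3}, {1, 5}, {1, 6}, 
       {2, 3}, {2, 4}, {2, 6}, {3, 5}, {4, 5}, {5, 6}}\<rparr>"

lemma simple_graph_13: "simple_graph graph_13"
  by (simp add: simple_graph_def graph_13_def)

lemma card_graph_13: "card (verts graph_13) = 7" "card (edges graph_13) = 13"
  by (simp_all add: graph_13_def card_insert_if doubleton_eq_iff)

text \<open>Every matching of the graph is disjoint from one of the nine Hamiltonian cycles listed in the
  proof.\<close>

lemma arrows_graph_13: "arrows graph_13 (path_graph 3) (cycle_graph 7)"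
  unfolding arrows_def
proof (rule allI, rule ccontr)
  fix c :: "nat set \<Rightarrow> color"
  assume "\<not> (contains_copy (color_subgraph graph_13 c Red) (path_graph 3) \<or>
    contains_copy (color_subgraph graph_13 c Blue) (cycle_graph 7))"
  then have no_P3: "\<not> contains_copy (color_subgraph graph_13 c Red) (path_graph 3)"
    and no_C7: "\<not> contains_copy (color_subgraph graph_13 c Blue) (cycle_graph 7)"
    by blast+
  let ?R = "\<lambda>x y. c {x, y} = Red"
  have matching: "\<not> (c e = Red \<and> c e' = Red)"
    if e: "e \<in> edges graph_13" "e' \<in> edges graph_13" "e \<noteq> e'" "e \<inter> e' \<noteq> {}" for e e'
  proof
    assume red: "c e = Red \<and> c e' = Red"
    obtain y where y: "y \<in> e" "y \<in> e'"
      using e by blast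
    have e_props: "card e = 2" "card e' = 2" "e \<subseteq> verts graph_13" "e' \<subseteq> verts graph_13"
      using e simple_graph_13 by (auto simp: simple_graph_def)
    obtain x where x: "e = {x, y}" "x \<noteq> y"
      using y e_props by (auto simp: card_2_iff)
    obtain z where z: "e' = {y, z}" "y \<noteq> z"
      using y e_props by (auto simp: card_2_iff)
    have "contains_copy (color_subgraph graph_13 c Red) (path_graph 3)"
    proof (rule contains_path_graph_3)
      show "distinct [x, y, z]"
        using x z e(3) by (auto simp: insert_commute)
    qed (use x z red e e_props in \<open>auto simp: color_subgraph_def\<close>)
    then show False
      using no_P3 by blast
  qed
  \<comment> \<open>A Hamiltonian cycle of the graph without a red edge would be a blue
    \<open>C\<^sub>7\<close>.\<close>
  have some_red: "?R x0 x1 \<or> ?R x1 x2 \<or> ?R x2 x3 \<or> ?R x3 x4 \<or>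
      ?R x4 x5 \<or> ?R x5 x6 \<or> ?R x6 x0"
    if "distinct [x0, x1, x2, x3, x4, x5, x6]" "{x0, x1, x2, x3, x4, x5, x6} \<subseteq> {..<7}"
      "{{x0, x1}, {x1, x2}, {x2, x3}, {x3, x4}, {x4, x5}, {x5, x6}, {x6, x0}}
        \<subseteq> edges graph_13" for x0 x1 x2 x3 x4 x5 x6
  proof (rule ccontr)
    assume not: "\<not> ?thesis"
    let ?xs = "[x0, x1, x2, x3, x4, x5, x6]"
    have lt_7: "i < 7 \<longleftrightarrow> i \<in> {0, 1, 2, 3, 4, 5, 6}" for i :: nat
      by auto
    have blue: "c e = Blue" if "c e \<noteq> Red" for e
      using that by (cases "c e") auto
    have "contains_copy (color_subgraph graph_13 c Blue) (cycle_graph (length ?xs))"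
    proof (rule contains_cycle_graph)
      show "{?xs ! i, ?xs ! (Suc i mod length ?xs)} \<in> edges (color_subgraph graph_13 c Blue)"
        if "i < length ?xs" for i
      proof -
        have "i \<in> {0, 1, 2, 3, 4, 5, 6}"
          using that lt_7[of i] by simp
        then show ?thesis
          using not \<open>_ \<subseteq> edges graph_13\<close> by (elim insertE emptyE) (simp_all add: color_subgraph_def blue)
      qed
    qed (use that in \<open>auto simp: color_subgraph_def graph_13_def\<close>)
    moreover have "length ?xs = 7"
      by simp
    ultimately show False
      using no_C7 by metis
  qed
  have "?R 0 3 \<or> ?R 2 3 \<or> ?R 2 6 \<or> ?R 1 6 \<or> ?R 1 5 \<or> ?R 4 5 \<or> ?R 0 4"
    using some_red[of 0 3 2 6 1 5 4] by (simp add: graph_13_def insert_commute)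
  moreover have "?R 0 1 \<or> ?R 1 3 \<or> ?R 2 3 \<or> ?R 2 4 \<or> ?R 4 5 \<or> ?R 5 6 \<or> ?R 0 6"
    using some_red[of 0 1 3 2 4 5 6] by (simp add: graph_13_def insert_commute)
  moreover have "?R 0 1 \<or> ?R 1 3 \<or> ?R 3 5 \<or> ?R 5 6 \<or> ?R 2 6 \<or> ?R 2 4 \<or> ?R 0 4"
    using some_red[of 0 1 3 5 6 2 4] by (simp add: graph_13_def insert_commute)
  moreover have "?R 0 4 \<or> ?R 2 4 \<or> ?R 2 3 \<or> ?R 3 5 \<or> ?R 1 5 \<or> ?R 1 6 \<or> ?R 0 6"
    using some_red[of 0 4 2 3 5 1 6] by (simp add: graph_13_def insert_commute)
  moreover have "?R 0 1 \<or> ?R 1 3 \<or> ?R 2 3 \<or> ?R 2 6 \<or> ?R 5 6 \<or> ?R 4 5 \<or> ?R 0 4"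
    using some_red[of 0 1 3 2 6 5 4] by (simp add: graph_13_def insert_commute)
  moreover have "?R 0 1 \<or> ?R 1 3 \<or> ?R 3 5 \<or> ?R 4 5 \<or> ?R 2 4 \<or> ?R 2 6 \<or> ?R 0 6"
    using some_red[of 0 1 3 5 4 2 6] by (simp add: graph_13_def insert_commute)
  moreover have "?R 0 3 \<or> ?R 2 3 \<or> ?R 2 4 \<or> ?R 4 5 \<or> ?R 1 5 \<or> ?R 1 6 \<or> ?R 0 6"
    using some_red[of 0 3 2 4 5 1 6] by (simp add: graph_13_def insert_commute)
  moreover have "?R 0 3 \<or> ?R 3 5 \<or> ?R 1 5 \<or> ?R 1 6 \<or> ?R 2 6 \<or> ?R 2 4 \<or> ?R 0 4"
    using some_red[of 0 3 5 1 6 2 4] by (simp add: graph_13_def insert_commute)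
  moreover have "?R 0 4 \<or> ?R 4 5 \<or> ?R 1 5 \<or> ?R 1 3 \<or> ?R 2 3 \<or> ?R 2 6 \<or> ?R 0 6"
    using some_red[of 0 4 5 1 3 2 6] by (simp add: graph_13_def insert_commute)
  \<comment> \<open>One clause for each of the 36 pairs of edges with a common vertex. Together with
    the nine cycle clauses they are unsatisfiable as propositional formulas in the 13 edges.\<close>
  moreover have "\<not> (?R 0 1 \<and> ?R 0 3)" "\<not> (?R 0 1 \<and> ?R 0 4)" "\<not> (?R 0 3 \<and> ?R 0 4)"
    "\<not> (?R 0 1 \<and> ?R 0 6)" "\<not> (?R 0 3 \<and> ?R 0 6)" "\<not> (?R 0 4 \<and> ?R 0 6)"
    "\<not> (?R 0 1 \<and> ?R 1 3)" "\<not> (?R 0 1 \<and> ?R 1 5)" "\<not> (?R 1 3 \<and> ?R 1 5)"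
    "\<not> (?R 0 1 \<and> ?R 1 6)" "\<not> (?R 1 3 \<and> ?R 1 6)" "\<not> (?R 1 5 \<and> ?R 1 6)"
    "\<not> (?R 2 3 \<and> ?R 2 4)" "\<not> (?R 2 3 \<and> ?R 2 6)" "\<not> (?R 2 4 \<and> ?R 2 6)"
    "\<not> (?R 0 3 \<and> ?R 1 3)" "\<not> (?R 0 3 \<and> ?R 2 3)" "\<not> (?R 1 3 \<and> ?R 2 3)"
    "\<not> (?R 0 3 \<and> ?R 3 5)" "\<not> (?R 1 3 \<and> ?R 3 5)" "\<not> (?R 2 3 \<and> ?R 3 5)"
    "\<not> (?R 0 4 \<and> ?R 2 4)" "\<not> (?R 0 4 \<and> ?R 4 5)" "\<not> (?R 2 4 \<and> ?R 4 5)"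
    "\<not> (?R 1 5 \<and> ?R 3 5)" "\<not> (?R 1 5 \<and> ?R 4 5)" "\<not> (?R 3 5 \<and> ?R 4 5)"
    "\<not> (?R 1 5 \<and> ?R 5 6)" "\<not> (?R 3 5 \<and> ?R 5 6)" "\<not> (?R 4 5 \<and> ?R 5 6)"
    "\<not> (?R 0 6 \<and> ?R 1 6)" "\<not> (?R 0 6 \<and> ?R 2 6)" "\<not> (?R 1 6 \<and> ?R 2 6)"
    "\<not> (?R 0 6 \<and> ?R 5 6)" "\<not> (?R 1 6 \<and> ?R 5 6)" "\<not> (?R 2 6 \<and> ?R 5 6)"
    by (rule matching; simp add: graph_13_def doubleton_eq_iff)+
  ultimately show False
    by sat
qed

section \<open>The restricted size Ramsey number\<close>

text \<open>The empty matching, that is the all-blue colouring, already puts a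
  \<open>C\<^sub>7\<close> into \<open>F\<close>.\<close>

lemma card_verts_ge_7:
  assumes "simple_graph F" "arrows F (path_graph 3) (cycle_graph 7)"
  shows "7 \<le> card (verts F)"
proof -
  have "contains_copy \<lparr>verts = verts F, edges = edges F - {}\<rparr> (cycle_graph 7)"
    using assms(2) by (rule arrows_avoid_matching) simp
  then obtain f where "inj_on f {..<7::nat}" "f ` {..<7} \<subseteq> verts F"
    by (auto simp: contains_copy_def cycle_graph_def)
  then show ?thesis
    using assms(1) card_inj_on_le[of f "{..<7}" "verts F"] by (simp add: simple_graph_def)
qed

text \<open>The 13-edge graph has seven vertices, so one witness serves this minimum and the minimum
  over edge numbers.\<close>

lemma ramsey_number_P3_C7: "ramsey_number (path_graph 3) (cycle_graph 7) = 7"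
  unfolding ramsey_number_def
  using simple_graph_13 arrows_graph_13 card_graph_13(1) card_verts_ge_7
  by (intro Least_equality) blast+

lemma arrowing_graph_of_arrows:
  assumes F: "simple_graph F" "card (verts F) = 7" and arr: "arrows F (path_graph 3) (cycle_graph 7)"
  shows "arrowing_graph (verts F) (edges F)"
proof
  show "\<exists>C. spanning_cycle (verts F) (edges F - M) C" if "pairwise disjnt M" for M
    using spanning_cycle_of_copy[OF arrows_avoid_matching[OF arr that]] F(2) by auto
qed (use F in \<open>auto simp: simple_graph_def\<close>)

theorem theorem5: "restricted_size_ramsey_number (path_graph 3) (cycle_graph 7) = 13"
  unfolding restricted_size_ramsey_number_def ramsey_number_P3_C7
proof (rule Least_equality)
  show "\<exists>F :: nat graph. simple_graph F \<and> arrows F (path_graph 3) (cycle_graph 7) \<and>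
      card (verts F) = 7 \<and> card (edges F) = 13"
    using simple_graph_13 arrows_graph_13 card_graph_13 by blast
  show "13 \<le> m"
    if "\<exists>F :: nat graph. simple_graph F \<and> arrows F (path_graph 3) (cycle_graph 7) \<and>
      card (verts F) = 7 \<and> card (edges F) = m" for m
    using that arrowing_graph.card_edges_ge_13 arrowing_graph_of_arrows by blast
qed

end
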